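(* Let $(A_1(\tau),A_2(\tau))$, $\tau\in\mathbb{R}$, be a nontrivial (i.e. not identically zero) global solution of the ODE system $iA_1'=F_1(A_1,A_2)$, $iA_2'=F_2(A_1,A_2)$ (with $F_1,F_2$ as in the context). Let $\rho:=|A_1|^2+|A_2|^2$ (a conserved quantity, so a constant), $\mathcal{D}:=|A_1|^2-|A_2|^2$, $\mathcal{R}:=2\operatorname{Re}(\overline{A_1}A_2)$, $\mathcal{I}:=2\operatorname{Im}(\overline{A_1}A_2)$. Then $(A_1,A_2)$ is reconstructed from $\mathcal{D},\mathcal{R},\mathcal{I}$ as follows. (1) If $A_1(0)\neq 0$, then for all $\tau\in\mathbb{R}$ $$A_1(\tau)=(-1)^{k_1(\tau)}\sqrt{\tfrac{\rho+\mathcal{D}(\tau)}{2}}\,\tfrac{A_1(0)}{|A_1(0)|}\exp\Big(i\int_0^\tau \big(N_1(\tilde\tau)-\mathcal{V}(A_1(\tilde\tau),A_2(\tilde\tau))\big)d\tilde\tau\Big),$$ $$A_2(\tau)=(-1)^{k_1(\tau)}\tfrac{\mathcal{R}(\tau)+i\mathcal{I}(\tau)}{\sqrt{2(\rho+\mathcal{D}(\tau))}}\,\tfrac{A_1(0)}{|A_1(0)|}\exp\Big(i\int_0^\tau \big(N_1(\tilde\tau)-\mathcal{V}(A_1(\tilde\tau),A_2(\tilde\tau))\big)d\tilde\tau\Big),$$ where $k_1(\tau)$ is the number of $s\in[0,\tau]$ (if $\tau\ge0$), respectively $s\in[\tau,0]$ (if $\tau<0$), with $\rho+\mathcal{D}(s)=0$,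 and $$N_1:=\tfrac{\rho\mathcal{R}}{\rho+\mathcal{D}}p_1+\Big(-3\rho+\tfrac{\mathcal{I}^2}{\rho+\mathcal{D}}\Big)p_2+\Big(-\mathcal{D}+\tfrac{\mathcal{R}^2}{\rho+\mathcal{D}}\Big)p_3-(\rho+\mathcal{D})p_4+\Big(-\mathcal{R}-\tfrac{\rho\mathcal{R}}{\rho+\mathcal{D}}\Big)p_5 .$$ (2) If $A_2(0)\neq0$, then for all $\tau\in\mathbb{R}$ $$A_1(\tau)=(-1)^{k_2(\tau)}\tfrac{A_2(0)}{|A_2(0)|}\tfrac{\mathcal{R}(\tau)-i\mathcal{I}(\tau)}{\sqrt{2(\rho-\mathcal{D}(\tau))}}\exp\Big(i\int_0^\tau \big(N_2(\tilde\tau)-\mathcal{V}(A_1(\tilde\tau),A_2(\tilde\tau))\big)d\tilde\tau\Big),$$ $$A_2(\tau)=(-1)^{k_2(\tau)}\tfrac{A_2(0)}{|A_2(0)|}\sqrt{\tfrac{\rho-\mathcal{D}(\tau)}{2}}\exp\Big(i\int_0^\tau \big(N_2(\tilde\tau)-\mathcal{V}(A_1(\tilde\tau),A_2(\tilde\tau))\big)d\tilde\tau\Big),$$ where $k_2(\tau)$ is the number of $s\in[0,\tau]$ (if $\tau\ge0$), respectively $s\in[\tau,0]$ (if $\tau<0$), with $\rho-\mathcal{D}(s)=0$, and $$N_2:=-\tfrac{\rho\mathcal{R}}{\rho-\mathcal{D}}p_1+\Big(-3\rho+\tfrac{\mathcal{I}^2}{\rho-\mathcal{D}}\Big)p_2+\Big(\mathcal{D}+\tfrac{\mathcal{R}^2}{\rho-\mathcal{D}}\Big)p_3+(\rho-\mathcal{D})p_4+\Big(-\mathcal{R}-\tfrac{\rho\mathcal{R}}{\rho-\mathcal{D}}\Big)p_5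 .$$
   Context: Parameters: $p_1\ge0$, $p_2\in\mathbb{R}$, $p_3\ge0$, $p_4\in\mathbb{R}$, $p_5\ge0$, not all zero; $q_1,q_2,q_3\in\mathbb{R}$. The nonlinearities are $$F_1(u_1,u_2)=(3p_2+p_3+2p_4)|u_1|^2u_1+(p_1+p_5)(2|u_1|^2u_2+u_1^2\overline{u_2})+(p_2-p_3)(2u_1|u_2|^2+\overline{u_1}u_2^2)-(p_1-p_5)|u_2|^2u_2-4p_1\operatorname{Re}(\overline{u_1}u_2)u_1+\mathcal{V}(u_1,u_2)u_1,$$ $$F_2(u_1,u_2)=(p_1+p_5)|u_1|^2u_1+(p_2-p_3)(2|u_1|^2u_2+u_1^2\overline{u_2})-(p_1-p_5)(2u_1|u_2|^2+\overline{u_1}u_2^2)+(3p_2+p_3-2p_4)|u_2|^2u_2+4p_1\operatorname{Re}(\overline{u_1}u_2)u_2+\mathcal{V}(u_1,u_2)u_2,$$ with $\mathcal{V}(u_1,u_2)=q_1|u_1|^2+2q_2\operatorname{Re}(\overline{u_1}u_2)+q_3|u_2|^2$. One has $\mathcal{V}(A_1,A_2)=\frac{q_1+q_3}{2}\rho+\frac{q_1-q_3}{2}\mathcal{D}+q_2\mathcal{R}$, and $\rho^2=\mathcal{D}^2+\mathcal{R}^2+\mathcal{I}^2$; all solutions are global. Convention: in (1) the points where $\rho+\mathcal{D}=0$ (equivalently $A_1=0$) are isolated, so $k_1$ is finite, and the apparent singularities of $N_1$ and of the right-hand sides at these points are removable; the formulas are understood there by continuous extension. The same applies in (2) with $\rho-\mathcal{D}$,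 $N_2$, $k_2$. *)

theory Defs
  imports "HOL-Analysis.Analysis"
begin

definition calV :: "real \<Rightarrow> real \<Rightarrow> real \<Rightarrow> complex \<Rightarrow> complex \<Rightarrow> real" where
  "calV q1 q2 q3 u1 u2 =
     q1 * (cmod u1)\<^sup>2 + 2 * q2 * Re (cnj u1 * u2) + q3 * (cmod u2)\<^sup>2"

definition F1 :: "real \<Rightarrow> real \<Rightarrow> real \<Rightarrow> real \<Rightarrow> real \<Rightarrow> real \<Rightarrow> real \<Rightarrow> real
    \<Rightarrow> complex \<Rightarrow> complex \<Rightarrow> complex" where
  "F1 p1 p2 p3 p4 p5 q1 q2 q3 u1 u2 =
     of_real (3 * p2 + p3 + 2 * p4) * of_real ((cmod u1)\<^sup>2) * u1
     + of_real (p1 + p5) * (2 * of_real ((cmod u1)\<^sup>2) * u2 + u1\<^sup>2 * cnj u2)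
     + of_real (p2 - p3) * (2 * u1 * of_real ((cmod u2)\<^sup>2) + cnj u1 * u2\<^sup>2)
     - of_real (p1 - p5) * of_real ((cmod u2)\<^sup>2) * u2
     - of_real (4 * p1 * Re (cnj u1 * u2)) * u1
     + of_real (calV q1 q2 q3 u1 u2) * u1"

definition F2 :: "real \<Rightarrow> real \<Rightarrow> real \<Rightarrow> real \<Rightarrow> real \<Rightarrow> real \<Rightarrow> real \<Rightarrow> real
    \<Rightarrow> complex \<Rightarrow> complex \<Rightarrow> complex" where
  "F2 p1 p2 p3 p4 p5 q1 q2 q3 u1 u2 =
     of_real (p1 + p5) * of_real ((cmod u1)\<^sup>2) * u1
     + of_real (p2 - p3) * (2 * of_real ((cmod u1)\<^sup>2) * u2 + u1\<^sup>2 * cnj u2)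
     - of_real (p1 - p5) * (2 * u1 * of_real ((cmod u2)\<^sup>2) + cnj u1 * u2\<^sup>2)
     + of_real (3 * p2 + p3 - 2 * p4) * of_real ((cmod u2)\<^sup>2) * u2
     + of_real (4 * p1 * Re (cnj u1 * u2)) * u2
     + of_real (calV q1 q2 q3 u1 u2) * u2"

definition global_solution :: "real \<Rightarrow> real \<Rightarrow> real \<Rightarrow> real \<Rightarrow> real \<Rightarrow> real \<Rightarrow> real \<Rightarrow> real
    \<Rightarrow> (real \<Rightarrow> complex) \<Rightarrow> (real \<Rightarrow> complex) \<Rightarrow> bool" where
  "global_solution p1 p2 p3 p4 p5 q1 q2 q3 A1 A2 \<longleftrightarrow>
     (\<forall>t. A1 differentiable (at t) \<and> A2 differentiable (at t) \<and>
          \<i> * vector_derivative A1 (at t) = F1 p1 p2 p3 p4 p5 q1 q2 q3 (A1 t) (A2 t) \<and>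
          \<i> * vector_derivative A2 (at t) = F2 p1 p2 p3 p4 p5 q1 q2 q3 (A1 t) (A2 t))"

definition rho :: "(real \<Rightarrow> complex) \<Rightarrow> (real \<Rightarrow> complex) \<Rightarrow> real \<Rightarrow> real" where
  "rho A1 A2 t = (cmod (A1 t))\<^sup>2 + (cmod (A2 t))\<^sup>2"

definition calD :: "(real \<Rightarrow> complex) \<Rightarrow> (real \<Rightarrow> complex) \<Rightarrow> real \<Rightarrow> real" where
  "calD A1 A2 t = (cmod (A1 t))\<^sup>2 - (cmod (A2 t))\<^sup>2"

definition calR :: "(real \<Rightarrow> complex) \<Rightarrow> (real \<Rightarrow> complex) \<Rightarrow> real \<Rightarrow> real" where
  "calR A1 A2 t = 2 * Re (cnj (A1 t) * A2 t)"

definition calI :: "(real \<Rightarrow> complex) \<Rightarrow> (real \<Rightarrow> complex) \<Rightarrow> real \<Rightarrow> real" where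
  "calI A1 A2 t = 2 * Im (cnj (A1 t) * A2 t)"

definition Z1 :: "(real \<Rightarrow> complex) \<Rightarrow> (real \<Rightarrow> complex) \<Rightarrow> real set" where
  "Z1 A1 A2 = {s. rho A1 A2 s + calD A1 A2 s = 0}"

definition Z2 :: "(real \<Rightarrow> complex) \<Rightarrow> (real \<Rightarrow> complex) \<Rightarrow> real set" where
  "Z2 A1 A2 = {s. rho A1 A2 s - calD A1 A2 s = 0}"

definition time_span :: "real \<Rightarrow> real set" where
  "time_span \<tau> = (if \<tau> \<ge> 0 then {0..\<tau>} else {\<tau>..0})"

definition k1 :: "(real \<Rightarrow> complex) \<Rightarrow> (real \<Rightarrow> complex) \<Rightarrow> real \<Rightarrow> nat" where
  "k1 A1 A2 \<tau> = card (Z1 A1 A2 \<inter> time_span \<tau>)"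

definition k2 :: "(real \<Rightarrow> complex) \<Rightarrow> (real \<Rightarrow> complex) \<Rightarrow> real \<Rightarrow> nat" where
  "k2 A1 A2 \<tau> = card (Z2 A1 A2 \<inter> time_span \<tau>)"

(* On the points of Z1 (resp. Z2) the quotients below are Isabelle's x / 0 = 0;
   these junk values are replaced by limits with cont_ext before N1, N2 and the
   right-hand sides of the reconstruction formulas are used. *)

definition N1 :: "real \<Rightarrow> real \<Rightarrow> real \<Rightarrow> real \<Rightarrow> real
    \<Rightarrow> (real \<Rightarrow> complex) \<Rightarrow> (real \<Rightarrow> complex) \<Rightarrow> real \<Rightarrow> real" where
  "N1 p1 p2 p3 p4 p5 A1 A2 t =
     (let \<rho> = rho A1 A2 t; D = calD A1 A2 t; R = calR A1 A2 t; J = calI A1 A2 t in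
        \<rho> * R / (\<rho> + D) * p1
        + (- 3 * \<rho> + J\<^sup>2 / (\<rho> + D)) * p2
        + (- D + R\<^sup>2 / (\<rho> + D)) * p3
        - (\<rho> + D) * p4
        + (- R - \<rho> * R / (\<rho> + D)) * p5)"

definition N2 :: "real \<Rightarrow> real \<Rightarrow> real \<Rightarrow> real \<Rightarrow> real
    \<Rightarrow> (real \<Rightarrow> complex) \<Rightarrow> (real \<Rightarrow> complex) \<Rightarrow> real \<Rightarrow> real" where
  "N2 p1 p2 p3 p4 p5 A1 A2 t =
     (let \<rho> = rho A1 A2 t; D = calD A1 A2 t; R = calR A1 A2 t; J = calI A1 A2 t in
        - (\<rho> * R / (\<rho> - D)) * p1
        + (- 3 * \<rho> + J\<^sup>2 / (\<rho> - D)) * p2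
        + (D + R\<^sup>2 / (\<rho> - D)) * p3
        + (\<rho> - D) * p4
        + (- R - \<rho> * R / (\<rho> - D)) * p5)"

definition removable_on :: "real set \<Rightarrow> (real \<Rightarrow> 'a::t2_space) \<Rightarrow> bool" where
  "removable_on Z f \<longleftrightarrow> (\<forall>s\<in>Z. \<exists>l. (f \<longlongrightarrow> l) (at s))"

(* Lim is meaningful only where the limit exists, i.e. under removable_on Z f. *)
definition cont_ext :: "real set \<Rightarrow> (real \<Rightarrow> 'a::t2_space) \<Rightarrow> real \<Rightarrow> 'a" where
  "cont_ext Z f t = (if t \<in> Z then Lim (at t) f else f t)"

(* The interval integral is oriented: it changes sign when \<tau> < 0. *)

definition phase1 :: "real \<Rightarrow> real \<Rightarrow> real \<Rightarrow> real \<Rightarrow> real \<Rightarrow> real \<Rightarrow> real \<Rightarrow> real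
    \<Rightarrow> (real \<Rightarrow> complex) \<Rightarrow> (real \<Rightarrow> complex) \<Rightarrow> real \<Rightarrow> real" where
  "phase1 p1 p2 p3 p4 p5 q1 q2 q3 A1 A2 \<tau> =
     (LBINT s=0..\<tau>. (cont_ext (Z1 A1 A2) (N1 p1 p2 p3 p4 p5 A1 A2) s
                      - calV q1 q2 q3 (A1 s) (A2 s)))"

definition phase2 :: "real \<Rightarrow> real \<Rightarrow> real \<Rightarrow> real \<Rightarrow> real \<Rightarrow> real \<Rightarrow> real \<Rightarrow> real
    \<Rightarrow> (real \<Rightarrow> complex) \<Rightarrow> (real \<Rightarrow> complex) \<Rightarrow> real \<Rightarrow> real" where
  "phase2 p1 p2 p3 p4 p5 q1 q2 q3 A1 A2 \<tau> =
     (LBINT s=0..\<tau>. (cont_ext (Z2 A1 A2) (N2 p1 p2 p3 p4 p5 A1 A2) s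
                      - calV q1 q2 q3 (A1 s) (A2 s)))"

definition rhs11 :: "real \<Rightarrow> real \<Rightarrow> real \<Rightarrow> real \<Rightarrow> real \<Rightarrow> real \<Rightarrow> real \<Rightarrow> real
    \<Rightarrow> (real \<Rightarrow> complex) \<Rightarrow> (real \<Rightarrow> complex) \<Rightarrow> real \<Rightarrow> complex" where
  "rhs11 p1 p2 p3 p4 p5 q1 q2 q3 A1 A2 \<tau> =
     (- 1) ^ k1 A1 A2 \<tau>
     * of_real (sqrt ((rho A1 A2 \<tau> + calD A1 A2 \<tau>) / 2))
     * (A1 0 / of_real (cmod (A1 0)))
     * exp (\<i> * of_real (phase1 p1 p2 p3 p4 p5 q1 q2 q3 A1 A2 \<tau>))"

definition rhs12 :: "real \<Rightarrow> real \<Rightarrow> real \<Rightarrow> real \<Rightarrow> real \<Rightarrow> real \<Rightarrow> real \<Rightarrow> real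
    \<Rightarrow> (real \<Rightarrow> complex) \<Rightarrow> (real \<Rightarrow> complex) \<Rightarrow> real \<Rightarrow> complex" where
  "rhs12 p1 p2 p3 p4 p5 q1 q2 q3 A1 A2 \<tau> =
     (- 1) ^ k1 A1 A2 \<tau>
     * ((of_real (calR A1 A2 \<tau>) + \<i> * of_real (calI A1 A2 \<tau>))
        / of_real (sqrt (2 * (rho A1 A2 \<tau> + calD A1 A2 \<tau>))))
     * (A1 0 / of_real (cmod (A1 0)))
     * exp (\<i> * of_real (phase1 p1 p2 p3 p4 p5 q1 q2 q3 A1 A2 \<tau>))"

definition rhs21 :: "real \<Rightarrow> real \<Rightarrow> real \<Rightarrow> real \<Rightarrow> real \<Rightarrow> real \<Rightarrow> real \<Rightarrow> real
    \<Rightarrow> (real \<Rightarrow> complex) \<Rightarrow> (real \<Rightarrow> complex) \<Rightarrow> real \<Rightarrow> complex" where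
  "rhs21 p1 p2 p3 p4 p5 q1 q2 q3 A1 A2 \<tau> =
     (- 1) ^ k2 A1 A2 \<tau>
     * (A2 0 / of_real (cmod (A2 0)))
     * ((of_real (calR A1 A2 \<tau>) - \<i> * of_real (calI A1 A2 \<tau>))
        / of_real (sqrt (2 * (rho A1 A2 \<tau> - calD A1 A2 \<tau>))))
     * exp (\<i> * of_real (phase2 p1 p2 p3 p4 p5 q1 q2 q3 A1 A2 \<tau>))"

definition rhs22 :: "real \<Rightarrow> real \<Rightarrow> real \<Rightarrow> real \<Rightarrow> real \<Rightarrow> real \<Rightarrow> real \<Rightarrow> real
    \<Rightarrow> (real \<Rightarrow> complex) \<Rightarrow> (real \<Rightarrow> complex) \<Rightarrow> real \<Rightarrow> complex" where
  "rhs22 p1 p2 p3 p4 p5 q1 q2 q3 A1 A2 \<tau> =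
     (- 1) ^ k2 A1 A2 \<tau>
     * (A2 0 / of_real (cmod (A2 0)))
     * of_real (sqrt ((rho A1 A2 \<tau> - calD A1 A2 \<tau>) / 2))
     * exp (\<i> * of_real (phase2 p1 p2 p3 p4 p5 q1 q2 q3 A1 A2 \<tau>))"

end

theory Submission
  imports Defs
begin

text \<open>
  Where \<open>A1\<close> is nonzero, the equation gives \<open>A1' = (\<lambda> + i (N1 - V)) A1\<close> with \<open>\<lambda>\<close> real, so
  \<open>w = A1 exp (- i \<integral> (N1 - V))\<close> has constant direction \<open>w / |w|\<close> between zeros of \<open>A1\<close>. These
  zeros are simple: at a zero \<open>A1' = i (p1 - p5) \<rho> A2\<close>, and if \<open>p1 = p5\<close> then \<open>A1\<close> cannot
  vanish at all unless it is identically zero. At a simple zero the direction of \<open>w\<close> is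
  reversed, which produces the factor \<open>(-1)^k1\<close>. The formula for \<open>A2\<close> follows from
  \<open>2 cnj A1 A2 = R + i I\<close>. The second part is the first one applied to \<open>(A2, A1)\<close>, which solves
  the system with \<open>p1\<close>, \<open>p4\<close> negated and \<open>q1\<close>, \<open>q3\<close> exchanged.
\<close>

section \<open>Direction of a path with simple zeros\<close>

text \<open>Points of a T1 space are closed, so a punctured open neighbourhood of \<open>a\<close>
  is itself open and is a neighbourhood of each of its points.\<close>

lemma eventually_at_eventually_at:
  fixes a :: "'a::t1_space"
  assumes "\<forall>\<^sub>F t in at a. P t"
  shows "\<forall>\<^sub>F t in at a. \<forall>\<^sub>F s in at t. P s"
proof -
  obtain S where S: "open S" "a \<in> S" "\<And>t. t \<in> S \<Longrightarrow> t \<noteq> a \<Longrightarrow> P t"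
    using assms by (auto simp: eventually_at_topological)
  have "\<forall>\<^sub>F s in at t. P s" if "t \<in> S" "t \<noteq> a" for t
    unfolding eventually_at_topological
    by (rule exI[of _ "S - {a}"]) (use S that in \<open>auto intro: open_delete\<close>)
  then show ?thesis
    unfolding eventually_at_topological using S by blast
qed

text \<open>The value of \<open>f\<close> at a point of \<open>Z\<close> is left free, so
  \<open>f\<close> itself need not be locally constant. Its punctured limit value \<open>C\<close>
  is, and the real line is connected.\<close>

lemma eventually_const_at_imp_const:
  fixes f :: "real \<Rightarrow> 'a"
  assumes loc: "\<And>a. \<exists>c. (\<forall>\<^sub>F t in at a. f t = c) \<and> (a \<notin> Z \<longrightarrow> f a = c)"
    and "a \<notin> Z" "b \<notin> Z"
  shows "f a = f b"
proof -
  obtain C where C: "\<And>a. \<forall>\<^sub>F t in at a. f t = C a" "\<And>a. a \<notin> Z \<Longrightarrow> f a = C a"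
    using loc by metis
  have "C a = C b"
  proof (rule connected_local_const[of UNIV])
    show "\<forall>a\<in>UNIV. \<forall>\<^sub>F b in at a. C a = C b"
    proof
      fix a
      from eventually_at_eventually_at[OF C(1)[of a]]
      show "\<forall>\<^sub>F b in at a. C a = C b"
      proof (rule eventually_mono)
        fix b assume "\<forall>\<^sub>F s in at b. f s = C a"
        with C(1)[of b] have "\<forall>\<^sub>F s in at b. C a = C b"
          by eventually_elim simp
        then show "C a = C b" by simp
      qed
    qed
  qed auto
  then show ?thesis using C(2) assms by metis
qed

lemma card_Int_interval_split:
  fixes a b c :: real
  assumes "finite (Z \<inter> {a..c})" "b \<notin> Z" "a \<le> b" "b \<le> c"
  shows "card (Z \<inter> {a..c}) = card (Z \<inter> {a..b}) + card (Z \<inter> {b..c})"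
proof -
  have "Z \<inter> {a..c} = (Z \<inter> {a..b}) \<union> (Z \<inter> {b..c})" using assms by auto
  moreover have "(Z \<inter> {a..b}) \<inter> (Z \<inter> {b..c}) = {}"
    using \<open>b \<notin> Z\<close> by (auto dest: order_antisym)
  ultimately show ?thesis
    by (metis card_Un_disjoint assms(1) finite_Un)
qed

text \<open>To the left of 0 the counts should enter with the opposite sign, but only their parity
  matters, so they may be added. No endpoint lies in \<open>Z\<close>, hence no point is counted
  twice.\<close>

lemma card_time_span_parity:
  assumes fin: "\<And>a b. finite (Z \<inter> {a..b::real})"
    and "0 \<notin> Z" "x \<notin> Z" "y \<notin> Z" "x \<le> y"
  shows "(- 1 :: complex) ^ card (Z \<inter> time_span y)
       = (- 1) ^ card (Z \<inter> time_span x) * (- 1) ^ card (Z \<inter> {x..y})"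
proof -
  consider "0 \<le> x" | "x < 0" "0 \<le> y" | "y < 0" by linarith
  then show ?thesis
  proof cases
    case 1
    then show ?thesis
      using card_Int_interval_split[OF fin \<open>x \<notin> Z\<close>, of 0 y] assms
      by (simp add: time_span_def power_add)
  next
    case 2
    then show ?thesis
      using card_Int_interval_split[OF fin \<open>0 \<notin> Z\<close>, of x y] assms
      by (simp add: time_span_def power_add mult.assoc[symmetric] flip: power_mult_distrib)
  next
    case 3
    then show ?thesis
      using card_Int_interval_split[OF fin \<open>y \<notin> Z\<close>, of x 0] assms
      by (simp add: time_span_def power_add mult.commute mult.left_commute
          flip: power_mult_distrib)
  qed
qed

lemma has_vector_derivative_complexD:
  assumes "(w has_vector_derivative w') (at s within S)"
  shows "((\<lambda>t. Re (w t)) has_real_derivative Re w') (at s within S)"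
    and "((\<lambda>t. Im (w t)) has_real_derivative Im w') (at s within S)"
  using bounded_linear.has_vector_derivative[OF bounded_linear_Re assms]
    bounded_linear.has_vector_derivative[OF bounded_linear_Im assms]
  by (simp_all add: has_real_derivative_iff_has_vector_derivative)

lemma tendsto_div_vector_derivative:
  fixes w :: "real \<Rightarrow> complex"
  assumes "(w has_vector_derivative w') (at s)" "w s = 0"
  shows "((\<lambda>t. w t / of_real (t - s)) \<longlongrightarrow> w') (at s)"
  using has_vector_derivative_complexD[OF assms(1)] assms(2)
  unfolding tendsto_complex_iff has_field_derivative_iff
  by simp

lemma eventually_ne_zero_of_simple:
  fixes w :: "real \<Rightarrow> complex"
  assumes deriv: "(w has_vector_derivative w') (at s)" and simple: "w s = 0 \<Longrightarrow> w' \<noteq> 0"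
  shows "\<forall>\<^sub>F t in at s. w t \<noteq> 0"
proof (cases "w s = 0")
  case True
  from tendsto_imp_eventually_ne[OF tendsto_div_vector_derivative[OF deriv True] simple[OF True]]
  show ?thesis by eventually_elim auto
next
  case False
  then show ?thesis
    using has_vector_derivative_continuous[OF deriv]
    by (auto simp: continuous_at intro: tendsto_imp_eventually_ne)
qed

text \<open>A real logarithmic derivative moves \<open>w\<close> radially: both \<open>w\<close> and
  \<open>cmod w\<close> grow at rate \<open>l\<close>, so \<open>w / cmod w\<close> has derivative
  zero.\<close>

lemma sgn_const_of_real_log_derivative:
  fixes w :: "real \<Rightarrow> complex"
  assumes "x \<le> y"
    and w: "\<And>t. t \<in> {x..y} \<Longrightarrow> w t \<noteq> 0"
    and deriv: "\<And>t. t \<in> {x..y} \<Longrightarrow> (w has_vector_derivative of_real (l t) * w t) (at t)"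
  shows "sgn (w x) = sgn (w y)"
proof -
  have "\<exists>c. \<forall>t\<in>{x..y}. of_real (inverse (cmod (w t))) * w t = c"
  proof (rule has_vector_derivative_zero_constant)
    fix t assume t: "t \<in> {x..y}"
    have r: "((\<lambda>t. Re (w t)) has_real_derivative l t * Re (w t)) (at t)"
      and i: "((\<lambda>t. Im (w t)) has_real_derivative l t * Im (w t)) (at t)"
      using has_vector_derivative_complexD[OF deriv[OF t]] by simp_all
    have pos: "(Re (w t))\<^sup>2 + (Im (w t))\<^sup>2 > 0"
      using w[OF t] by (simp add: complex_eq_iff sum_power2_gt_zero_iff)
    have "((\<lambda>t. (Re (w t))\<^sup>2 + (Im (w t))\<^sup>2) has_real_derivative
        2 * l t * ((Re (w t))\<^sup>2 + (Im (w t))\<^sup>2)) (at t)"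
      using DERIV_add[OF DERIV_power[OF r, of 2] DERIV_power[OF i, of 2]]
      by (elim DERIV_cong) (simp add: algebra_simps power2_eq_square)
    from DERIV_chain2[OF DERIV_real_sqrt[OF pos] this]
    have "((\<lambda>t. cmod (w t)) has_real_derivative
        inverse (cmod (w t)) / 2 * (2 * l t * (cmod (w t))\<^sup>2)) (at t)"
      by (simp add: cmod_def)
    then have "((\<lambda>t. cmod (w t)) has_real_derivative l t * cmod (w t)) (at t)"
      by (rule DERIV_cong) (use w[OF t] in \<open>simp add: power2_eq_square\<close>)
    from DERIV_inverse'[OF this]
    have n: "((\<lambda>t. inverse (cmod (w t))) has_real_derivative - l t * inverse (cmod (w t))) (at t)"
      by (rule DERIV_cong) (use w[OF t] in simp_all)
    show "((\<lambda>t. of_real (inverse (cmod (w t))) * w t) has_vector_derivative 0) (at t within {x..y})"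
      using has_vector_derivative_at_within[OF
          has_vector_derivative_mult[OF has_vector_derivative_of_real[OF n] deriv[OF t]]]
      by (simp add: algebra_simps)
  qed auto
  then obtain c where c: "\<And>t. t \<in> {x..y} \<Longrightarrow> of_real (inverse (cmod (w t))) * w t = c"
    by blast
  then have "of_real (inverse (cmod (w x))) * w x = of_real (inverse (cmod (w y))) * w y"
    using \<open>x \<le> y\<close> by (metis atLeastAtMost_iff order_refl)
  then show ?thesis
    by (simp add: sgn_div_norm scaleR_conv_of_real)
qed

text \<open>Abstracts the rotated path \<open>A1 * exp (- i * phase)\<close>: it moves along a ray
  away from its zeros and passes through each zero with nonzero velocity.\<close>

locale simple_zero_path =
  fixes w w' :: "real \<Rightarrow> complex" and l :: "real \<Rightarrow> real"
  assumes deriv: "(w has_vector_derivative w' t) (at t)"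
    and simple: "w s = 0 \<Longrightarrow> w' s \<noteq> 0"
    and log_deriv: "w t \<noteq> 0 \<Longrightarrow> w' t = of_real (l t) * w t"
begin

lemma eventually_nonzero: "\<forall>\<^sub>F t in at s. w t \<noteq> 0"
  by (rule eventually_ne_zero_of_simple) (use deriv simple in auto)

lemma finite_zeros: "finite ({t. w t = 0} \<inter> {a..b})"
proof -
  have "finite ({a..b} \<inter> {t. w t = 0})"
    by (rule finite_not_islimpt_in_compact)
      (use eventually_nonzero in \<open>auto simp: islimpt_iff_eventually\<close>)
  then show ?thesis by (simp add: Int_commute)
qed

lemma isolated:
  obtains d where "d > 0" "\<And>t. t \<noteq> s \<Longrightarrow> \<bar>t - s\<bar> \<le> d \<Longrightarrow> w t \<noteq> 0"
proof -
  obtain d where "d > 0" "\<And>t. t \<noteq> s \<Longrightarrow> dist t s < d \<Longrightarrow> w t \<noteq> 0"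
    using eventually_nonzero[of s] unfolding eventually_at by blast
  \<comment> \<open>Halving gives a closed neighbourhood, so that the endpoints \<open>s - d\<close>
    and \<open>s + d\<close> can serve as reference points.\<close>
  then show ?thesis using that[of "d/2"] by (auto simp: dist_real_def)
qed

lemma sgn_const:
  assumes "x \<le> y" "\<And>t. t \<in> {x..y} \<Longrightarrow> w t \<noteq> 0"
  shows "sgn (w x) = sgn (w y)"
proof (rule sgn_const_of_real_log_derivative[where l = l])
  show "(w has_vector_derivative of_real (l t) * w t) (at t)" if "t \<in> {x..y}" for t
    using deriv[of t] log_deriv[of t] assms(2)[OF that] by simp
qed (use assms in auto)

text \<open>The quotient \<open>w t / (t - s)\<close> tends to \<open>w' s\<close>, which is
  nonzero, so its direction has the same limit from both sides. The denominator is positive on the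
  right and negative on the left, while \<open>sgn (w t)\<close> is constant on each side.\<close>

lemma sgn_flip:
  assumes "w s = 0" "d > 0" and nz: "\<And>t. t \<noteq> s \<Longrightarrow> \<bar>t - s\<bar> \<le> d \<Longrightarrow> w t \<noteq> 0"
  shows "sgn (w (s + d)) = - sgn (w (s - d))"
proof -
  let ?q = "\<lambda>t. sgn (w t / of_real (t - s))"
  have lim: "(?q \<longlongrightarrow> sgn (w' s)) (at s)"
    by (intro tendsto_sgn tendsto_div_vector_derivative deriv simple assms)
  have "(?q \<longlongrightarrow> sgn (w (s + d))) (at_right s)"
  proof (rule tendsto_eventually)
    have "\<forall>\<^sub>F t in at_right s. t \<in> {s<..<s+d}"
      using \<open>d > 0\<close> by (intro eventually_at_right_real) auto
    then show "\<forall>\<^sub>F t in at_right s. ?q t = sgn (w (s + d))"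
    proof eventually_elim
      case (elim t)
      then have "sgn (w t) = sgn (w (s + d))" by (intro sgn_const nz) auto
      moreover have "sgn (complex_of_real (t - s)) = 1"
        using elim unfolding sgn_of_real by simp
      ultimately show ?case
        by (simp add: sgn_divide del: of_real_diff)
    qed
  qed
  then have "sgn (w (s + d)) = sgn (w' s)"
    using lim by (meson filterlim_at_split tendsto_unique trivial_limit_at_right_real)
  moreover
  have "(?q \<longlongrightarrow> - sgn (w (s - d))) (at_left s)"
  proof (rule tendsto_eventually)
    have "\<forall>\<^sub>F t in at_left s. t \<in> {s-d<..<s}"
      using \<open>d > 0\<close> by (intro eventually_at_left_real) auto
    then show "\<forall>\<^sub>F t in at_left s. ?q t = - sgn (w (s - d))"
    proof eventually_elim
      case (elim t)
      then have "sgn (w (s - d)) = sgn (w t)" by (intro sgn_const nz) auto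
      moreover have "sgn (complex_of_real (t - s)) = - 1"
        using elim unfolding sgn_of_real by simp
      ultimately show ?case
        by (simp add: sgn_divide del: of_real_diff)
    qed
  qed
  then have "- sgn (w (s - d)) = sgn (w' s)"
    using lim by (meson filterlim_at_split tendsto_unique trivial_limit_at_left_real)
  ultimately show ?thesis by simp
qed

text \<open>The product of parity and direction is locally constant off the zeros: passing a zero
  reverses both factors.\<close>

lemma sgn_eq_parity:
  assumes "w 0 \<noteq> 0" "w t \<noteq> 0"
  shows "sgn (w t) = (- 1) ^ card ({t. w t = 0} \<inter> time_span t) * sgn (w 0)"
proof -
  let ?Z = "{t. w t = 0}"
  let ?k = "\<lambda>t. (- 1 :: complex) ^ card (?Z \<inter> time_span t)"
  let ?f = "\<lambda>t. ?k t * sgn (w t)"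
  have loc: "\<exists>c. (\<forall>\<^sub>F t in at s. ?f t = c) \<and> (s \<notin> ?Z \<longrightarrow> ?f s = c)" for s
  proof -
    obtain d where d: "d > 0" "\<And>t. t \<noteq> s \<Longrightarrow> \<bar>t - s\<bar> \<le> d \<Longrightarrow> w t \<noteq> 0"
      using isolated[of s] by blast
    have eq: "?f t = ?f (s - d)" if t: "w t \<noteq> 0" "\<bar>t - s\<bar> \<le> d" for t
    proof -
      have par: "?k t = ?k (s - d) * (- 1) ^ card (?Z \<inter> {s - d..t})"
        by (rule card_time_span_parity[OF finite_zeros]) (use assms d t in auto)
      show ?thesis
      \<comment> \<open>The only possible zero between \<open>s - d\<close> and \<open>t\<close> is
        \<open>s\<close>. If it is passed, the count grows by one and the direction is reversed;
        otherwise neither factor changes.\<close>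
      proof (cases "s \<le> t \<and> w s = 0")
        case True
        then have st: "s < t" using t by (cases "s = t") auto
        have "?Z \<inter> {s - d..t} = {s}" using True t d by (auto, smt (verit))
        then have "?k t = - ?k (s - d)" using par by simp
        moreover have "sgn (w t) = - sgn (w (s - d))"
        proof -
          have "sgn (w t) = sgn (w (s + d))"
            using st t d by (intro sgn_const) auto
          then show ?thesis using sgn_flip[of s d] True d by simp
        qed
        ultimately show ?thesis by simp
      next
        case False
        then have nz: "w x \<noteq> 0" if "x \<in> {s - d..t}" for x
          using that t d by (cases "x = s") auto
        then have "?Z \<inter> {s - d..t} = {}" by auto
        then have "?k t = ?k (s - d)" using par by simp
        moreover have "sgn (w (s - d)) = sgn (w t)"
          using nz t by (intro sgn_const) auto
        ultimately show ?thesis by simp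
      qed
    qed
    have "\<forall>\<^sub>F t in at s. ?f t = ?f (s - d)"
      unfolding eventually_at
      by (rule exI[of _ d]) (use d in \<open>auto simp: dist_real_def intro!: eq\<close>)
    moreover have "s \<notin> ?Z \<longrightarrow> ?f s = ?f (s - d)"
      using eq[of s] d(1) by (simp only: mem_Collect_eq) simp
    ultimately show ?thesis by blast
  qed
  have "?f 0 = ?f t"
    by (rule eventually_const_at_imp_const[OF loc]) (use assms in auto)
  \<comment> \<open>The square of \<open>?k t\<close> is 1, and \<open>?k 0\<close> is 1 because 0
    is not a zero.\<close>
  then have "?k t * ?f 0 = ?k t * ?f t" by simp
  then show ?thesis
    using assms(1) by (simp add: time_span_def mult.assoc[symmetric] flip: power_mult_distrib)
qed

end

section \<open>Continuous extension and differential inequalities\<close>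

text \<open>Gronwall in both time directions: \<open>f t * exp (- K * t)\<close> is nonincreasing
  and \<open>f t * exp (K * t)\<close> is nondecreasing.\<close>

lemma zero_of_abs_deriv_le:
  fixes f f' :: "real \<Rightarrow> real"
  assumes deriv: "\<And>t. (f has_real_derivative f' t) (at t)"
    and bound: "\<And>t. \<bar>f' t\<bar> \<le> K * f t" and nonneg: "\<And>t. f t \<ge> 0" and "f s = 0"
  shows "f t = 0"
proof (cases "s \<le> t")
  case True
  have "f t * exp (- K * t) \<le> f s * exp (- K * s)"
  proof (rule DERIV_nonpos_imp_nonincreasing[OF True])
    fix x
    have "((\<lambda>t. f t * exp (- K * t)) has_real_derivative (f' x - K * f x) * exp (- K * x)) (at x)"
      by (auto intro!: derivative_eq_intros deriv[THEN DERIV_cong] simp: algebra_simps)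
    moreover have "(f' x - K * f x) * exp (- K * x) \<le> 0"
      using bound[of x] by (intro mult_nonpos_nonneg) auto
    ultimately show "\<exists>y. ((\<lambda>t. f t * exp (- K * t)) has_real_derivative y) (at x) \<and> y \<le> 0"
      by blast
  qed
  then have "f t \<le> 0" using \<open>f s = 0\<close> by (simp add: mult_le_0_iff)
  with nonneg[of t] show ?thesis by simp
next
  case False
  then have "t \<le> s" by simp
  have "f t * exp (K * t) \<le> f s * exp (K * s)"
  proof (rule DERIV_nonneg_imp_nondecreasing[OF \<open>t \<le> s\<close>])
    fix x
    have "((\<lambda>t. f t * exp (K * t)) has_real_derivative (f' x + K * f x) * exp (K * x)) (at x)"
      by (auto intro!: derivative_eq_intros deriv[THEN DERIV_cong] simp: algebra_simps)
    moreover have "(f' x + K * f x) * exp (K * x) \<ge> 0"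
      using bound[of x] by (intro mult_nonneg_nonneg) auto
    ultimately show "\<exists>y. ((\<lambda>t. f t * exp (K * t)) has_real_derivative y) (at x) \<and> 0 \<le> y"
      by blast
  qed
  then have "f t \<le> 0" using \<open>f s = 0\<close> by (simp add: mult_le_0_iff)
  with nonneg[of t] show ?thesis by simp
qed

lemma tendsto_cont_ext:
  fixes f :: "real \<Rightarrow> 'a::t2_space"
  assumes "removable_on Z f" and "s \<notin> Z \<Longrightarrow> isCont f s"
  shows "(f \<longlongrightarrow> cont_ext Z f s) (at s)"
proof (cases "s \<in> Z")
  case True
  then obtain l where "(f \<longlongrightarrow> l) (at s)"
    using assms(1) unfolding removable_on_def by blast
  with True show ?thesis
    by (simp add: cont_ext_def tendsto_Lim)
next
  case False
  then show ?thesis using assms(2) by (simp add: cont_ext_def isCont_def)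
qed

lemma isCont_cont_ext:
  fixes f :: "real \<Rightarrow> 'a::t2_space"
  assumes "removable_on Z f" and "s \<notin> Z \<Longrightarrow> isCont f s" and "\<forall>\<^sub>F t in at s. t \<notin> Z"
  shows "isCont (cont_ext Z f) s"
proof -
  have "\<forall>\<^sub>F t in at s. f t = cont_ext Z f t"
    using assms(3) by eventually_elim (simp add: cont_ext_def)
  then show ?thesis
    using tendsto_cont_ext[OF assms(1,2)] unfolding isCont_def
    by (rule Lim_transform_eventually[rotated])
qed

lemma has_derivative_interval_integral:
  fixes f :: "real \<Rightarrow> real"
  assumes "\<And>t. isCont f t"
  shows "((\<lambda>u. LBINT s=0..u. f s) has_real_derivative f t) (at t)"
proof -
  \<comment> \<open>This interval has both 0 and \<open>t\<close> in its interior, which covers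
    either sign of \<open>t\<close> and makes the derivative two-sided.\<close>
  let ?a = "min t 0 - 1" and ?b = "max t 0 + 1"
  have "((\<lambda>u. LBINT s=ereal 0..u. f s) has_vector_derivative f t) (at t within {?a..?b})"
    using assms by (intro interval_integral_FTC2 continuous_at_imp_continuous_on) auto
  moreover have "at t within {?a..?b} = at t"
    by (rule at_within_interior) (auto simp: interior_atLeastAtMost_real)
  ultimately show ?thesis
    by (simp add: has_real_derivative_iff_has_vector_derivative zero_ereal_def)
qed

section \<open>The cubic system\<close>

lemma cmod_square_Re_Im: "(cmod z)\<^sup>2 = Re z * Re z + Im z * Im z"
  unfolding cmod_power2 by (simp add: power2_eq_square)

text \<open>The imaginary part drives \<open>cmod u1\<close> and the real part drives the argument
  of \<open>u1\<close>. The potential is real, so it enters only the latter.\<close>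

lemma cnj_mult_F1:
  shows Im_cnj_mult_F1: "Im (cnj u1 * F1 p1 p2 p3 p4 p5 q1 q2 q3 u1 u2) =
      ((p1 + p5) * (cmod u1)\<^sup>2 + 2 * (p2 - p3) * Re (cnj u1 * u2) - (p1 - p5) * (cmod u2)\<^sup>2)
        * Im (cnj u1 * u2)"
    and Re_cnj_mult_F1: "Re (cnj u1 * F1 p1 p2 p3 p4 p5 q1 q2 q3 u1 u2) =
      (3 * p2 + p3 + 2 * p4) * ((cmod u1)\<^sup>2)\<^sup>2 + (3 * p5 - p1) * (cmod u1)\<^sup>2 * Re (cnj u1 * u2)
      + (p2 - p3) * (3 * (Re (cnj u1 * u2))\<^sup>2 + (Im (cnj u1 * u2))\<^sup>2)
      - (p1 - p5) * (cmod u2)\<^sup>2 * Re (cnj u1 * u2) + calV q1 q2 q3 u1 u2 * (cmod u1)\<^sup>2"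
  unfolding F1_def calV_def cmod_square_Re_Im by (simp_all add: power2_eq_square algebra_simps)

lemma Im_cnj_mult_F2:
  "Im (cnj u2 * F2 p1 p2 p3 p4 p5 q1 q2 q3 u1 u2) = - Im (cnj u1 * F1 p1 p2 p3 p4 p5 q1 q2 q3 u1 u2)"
  unfolding F1_def F2_def calV_def cmod_square_Re_Im
  by (simp add: power2_eq_square algebra_simps)

text \<open>Computes the derivative of \<open>calR\<close>. The potential cancels because
  \<open>cnj u2 * u1 + cnj u1 * u2\<close> is real.\<close>

lemma Im_cnj_mult_F1_F2:
  "Im (cnj u2 * F1 p1 p2 p3 p4 p5 q1 q2 q3 u1 u2 + cnj u1 * F2 p1 p2 p3 p4 p5 q1 q2 q3 u1 u2) =
     2 * Im (cnj u1 * u2) * (2 * p1 * Re (cnj u1 * u2) - (p2 + p3) * ((cmod u1)\<^sup>2 - (cmod u2)\<^sup>2)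
       - p4 * ((cmod u1)\<^sup>2 + (cmod u2)\<^sup>2))"
  unfolding F1_def F2_def calV_def cmod_square_Re_Im
  by (simp add: power2_eq_square algebra_simps)

lemma F_swap:
  "F1 (- p1) p2 p3 (- p4) p5 q3 q2 q1 u2 u1 = F2 p1 p2 p3 p4 p5 q1 q2 q3 u1 u2"
  "F2 (- p1) p2 p3 (- p4) p5 q3 q2 q1 u2 u1 = F1 p1 p2 p3 p4 p5 q1 q2 q3 u1 u2"
  by (auto simp: F1_def F2_def calV_def algebra_simps)

section \<open>Conservation of \<rho> and evolution of the quadratic quantities\<close>

locale cubic_solution =
  fixes p1 p2 p3 p4 p5 q1 q2 q3 :: real and A1 A2 :: "real \<Rightarrow> complex"
  assumes sol: "global_solution p1 p2 p3 p4 p5 q1 q2 q3 A1 A2"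
begin

abbreviation "f1 t \<equiv> F1 p1 p2 p3 p4 p5 q1 q2 q3 (A1 t) (A2 t)"
abbreviation "f2 t \<equiv> F2 p1 p2 p3 p4 p5 q1 q2 q3 (A1 t) (A2 t)"
abbreviation "Z \<equiv> Z1 A1 A2"
abbreviation "N \<equiv> N1 p1 p2 p3 p4 p5 A1 A2"
abbreviation "\<rho> \<equiv> rho A1 A2"
abbreviation "D \<equiv> calD A1 A2"
abbreviation "R \<equiv> calR A1 A2"
abbreviation "J \<equiv> calI A1 A2"
abbreviation "V t \<equiv> calV q1 q2 q3 (A1 t) (A2 t)"
abbreviation "\<phi> \<equiv> phase1 p1 p2 p3 p4 p5 q1 q2 q3 A1 A2"

lemma A_deriv:
  "(A1 has_vector_derivative - \<i> * f1 t) (at t)"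
  "(A2 has_vector_derivative - \<i> * f2 t) (at t)"
proof -
  have "vector_derivative A1 (at t) = - \<i> * f1 t" "vector_derivative A2 (at t) = - \<i> * f2 t"
    using sol unfolding global_solution_def
    by (metis (no_types, lifting) complex_i_mult_minus mult_minus_left minus_minus)+
  moreover have "A1 differentiable at t" "A2 differentiable at t"
    using sol unfolding global_solution_def by auto
  ultimately show "(A1 has_vector_derivative - \<i> * f1 t) (at t)"
    "(A2 has_vector_derivative - \<i> * f2 t) (at t)"
    by (metis vector_derivative_works)+
qed

lemma isCont_A: "isCont A1 t" "isCont A2 t"
  using A_deriv by (auto intro: has_vector_derivative_continuous)

text \<open>With \<open>w' = - i f\<close>, the derivative of the squared modulus is
  \<open>2 Re (cnj w * w') = 2 Im (cnj w * f)\<close>. Expressing both rates through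
  \<open>f1\<close> makes their cancellation in \<rho> visible.\<close>

lemma cmod_square_deriv:
  "((\<lambda>t. (cmod (A1 t))\<^sup>2) has_real_derivative 2 * Im (cnj (A1 t) * f1 t)) (at t)"
  "((\<lambda>t. (cmod (A2 t))\<^sup>2) has_real_derivative - 2 * Im (cnj (A1 t) * f1 t)) (at t)"
proof -
  have aux: "((\<lambda>t. (cmod (w t))\<^sup>2) has_real_derivative 2 * Im (cnj (w t) * f)) (at t)"
    if "(w has_vector_derivative - \<i> * f) (at t)" for w :: "real \<Rightarrow> complex" and f
    using DERIV_add[OF DERIV_power[OF has_vector_derivative_complexD(1)[OF that], of 2]
        DERIV_power[OF has_vector_derivative_complexD(2)[OF that], of 2]]
    unfolding cmod_power2 by (rule DERIV_cong) (simp add: algebra_simps)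
  show "((\<lambda>t. (cmod (A1 t))\<^sup>2) has_real_derivative 2 * Im (cnj (A1 t) * f1 t)) (at t)"
    by (rule aux[OF A_deriv(1)])
  show "((\<lambda>t. (cmod (A2 t))\<^sup>2) has_real_derivative - 2 * Im (cnj (A1 t) * f1 t)) (at t)"
    by (rule DERIV_cong[OF aux[OF A_deriv(2)]]) (simp only: Im_cnj_mult_F2 mult_minus_right mult_minus_left)
qed

lemma rho_const: "\<rho> s = \<rho> t"
proof (rule DERIV_isconst_all[of \<rho>], rule allI)
  show "(\<rho> has_real_derivative 0) (at t)" for t
    using DERIV_add[OF cmod_square_deriv(1,2)[of t]] unfolding rho_def[abs_def] by simp
qed

lemma cnj_mult_deriv:
  "((\<lambda>t. cnj (A1 t) * A2 t) has_vector_derivative \<i> * (cnj (f1 t) * A2 t - cnj (A1 t) * f2 t)) (at t)"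
  using has_vector_derivative_mult[OF has_vector_derivative_cnj[OF A_deriv(1)] A_deriv(2)]
  by (simp add: algebra_simps)

text \<open>The factor \<open>J\<close> is the point: at a zero of \<open>A1\<close> it vanishes, so
  \<open>R\<close> and its derivative vanish there together.\<close>

lemma calR_deriv:
  "(R has_real_derivative J t * (2 * p1 * R t - 2 * (p2 + p3) * D t - 2 * p4 * \<rho> t)) (at t)"
proof -
  have "(R has_real_derivative 2 * Re (\<i> * (cnj (f1 t) * A2 t - cnj (A1 t) * f2 t))) (at t)"
    using DERIV_cmult[OF has_vector_derivative_complexD(1)[OF cnj_mult_deriv], of 2]
    unfolding calR_def by simp
  also have "2 * Re (\<i> * (cnj (f1 t) * A2 t - cnj (A1 t) * f2 t))
      = 2 * Im (cnj (A2 t) * f1 t + cnj (A1 t) * f2 t)"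
    by (simp add: algebra_simps)
  also have "\<dots> = J t * (2 * p1 * R t - 2 * (p2 + p3) * D t - 2 * p4 * \<rho> t)"
    unfolding Im_cnj_mult_F1_F2 calR_def calI_def calD_def rho_def by (simp only: algebra_simps)
  finally show ?thesis .
qed

lemma isCont_quadratic: "isCont \<rho> t" "isCont D t" "isCont R t" "isCont J t" "isCont V t"
  using isCont_A[of t] unfolding isCont_def rho_def calD_def calR_def calI_def calV_def
  by (auto intro!: tendsto_intros)

lemma mem_Z_iff: "t \<in> Z \<longleftrightarrow> A1 t = 0"
  by (simp add: Z1_def rho_def calD_def)

lemma rho_pos:
  assumes "A1 0 \<noteq> 0"
  shows "\<rho> t > 0"
  using assms rho_const[of t 0] by (simp add: rho_def add_pos_nonneg)

text \<open>If \<open>p1 = p5\<close>, the hyperplane \<open>u1 = 0\<close> is invariant, so a solution starting outside it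
  never meets it; otherwise the vector field crosses it transversally.\<close>

lemma A1_eq_zero_if_degenerate:
  assumes "p1 = p5" "A1 s = 0"
  shows "A1 t = 0"
proof -
  \<comment> \<open>The outer 2 comes from differentiating a square; the two summands bound the two
    terms left in \<open>Im (cnj (A1 t) * f1 t)\<close> when \<open>p1 = p5\<close>, each relative
    to \<open>?a\<close>.\<close>
  let ?K = "2 * (2 * \<bar>p1\<bar> * \<rho> 0 + 2 * \<bar>p2 - p3\<bar> * \<rho> 0)"
  have "(cmod (A1 t))\<^sup>2 = 0"
  proof (rule zero_of_abs_deriv_le[where K = ?K, OF cmod_square_deriv(1)])
    fix t
    let ?a = "(cmod (A1 t))\<^sup>2" and ?z = "cnj (A1 t) * A2 t"
    have z: "cmod ?z = cmod (A1 t) * cmod (A2 t)" by (simp add: norm_mult)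
    have "2 * (cmod (A1 t) * cmod (A2 t)) \<le> \<rho> 0"
      using sum_squares_bound[of "cmod (A1 t)" "cmod (A2 t)"] rho_const[of 0 t]
      by (simp add: rho_def)
    then have zr: "cmod ?z \<le> \<rho> 0"
      unfolding z using norm_ge_zero[of "A1 t"] norm_ge_zero[of "A2 t"]
      by (smt (verit) mult_nonneg_nonneg)
    have im: "\<bar>Im ?z\<bar> \<le> \<rho> 0"
      using abs_Im_le_cmod[of ?z] zr by linarith
    have "\<bar>Re ?z * Im ?z\<bar> \<le> cmod ?z * cmod ?z"
      unfolding abs_mult by (intro mult_mono abs_Re_le_cmod abs_Im_le_cmod) auto
    also have "\<dots> = ?a * (cmod (A2 t))\<^sup>2"
      unfolding z by (simp add: power2_eq_square)
    also have "\<dots> \<le> ?a * \<rho> 0"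
      using rho_const[of 0 t] by (intro mult_left_mono) (auto simp: rho_def)
    finally have reim: "\<bar>Re ?z * Im ?z\<bar> \<le> ?a * \<rho> 0" .
    \<comment> \<open>For \<open>p1 = p5\<close> the term with the squared modulus of
      \<open>A2\<close>, the only one of first order in \<open>A1\<close>, disappears.\<close>
    have "Im (cnj (A1 t) * f1 t) = 2 * p1 * (?a * Im ?z) + 2 * (p2 - p3) * (Re ?z * Im ?z)"
      unfolding Im_cnj_mult_F1 \<open>p1 = p5\<close> by (simp only: algebra_simps)
    then have "\<bar>Im (cnj (A1 t) * f1 t)\<bar>
        \<le> 2 * \<bar>p1\<bar> * (?a * \<bar>Im ?z\<bar>) + 2 * \<bar>p2 - p3\<bar> * \<bar>Re ?z * Im ?z\<bar>"
      using abs_triangle_ineq[of "2 * p1 * (?a * Im ?z)" "2 * (p2 - p3) * (Re ?z * Im ?z)"]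
      by (simp only: abs_mult abs_numeral abs_power2 mult.assoc)
    also have "\<dots> \<le> 2 * \<bar>p1\<bar> * (?a * \<rho> 0) + 2 * \<bar>p2 - p3\<bar> * (?a * \<rho> 0)"
      by (intro add_mono mult_left_mono im reim) auto
    finally show "\<bar>2 * Im (cnj (A1 t) * f1 t)\<bar> \<le> ?K * ?a"
      by (simp add: algebra_simps)
  qed (use assms in auto)
  then show ?thesis by simp
qed

section \<open>Zeros of \<open>A1\<close> and removable singularities of \<open>N1\<close>\<close>

context
  assumes init: "A1 0 \<noteq> 0"
begin

lemma f1_at_zero:
  assumes "A1 s = 0"
  shows "f1 s = - of_real ((p1 - p5) * \<rho> s) * A2 s"
  using assms by (simp add: F1_def rho_def)

lemma simple_zero:
  assumes "A1 s = 0"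
  shows "f1 s \<noteq> 0"
proof -
  have "p1 \<noteq> p5" using A1_eq_zero_if_degenerate assms init by blast
  moreover have "A2 s \<noteq> 0" using rho_pos[OF init, of s] assms by (auto simp: rho_def)
  ultimately show ?thesis
    using rho_pos[OF init, of s] unfolding f1_at_zero[OF assms] by simp
qed

lemma eventually_not_in_Z: "\<forall>\<^sub>F t in at s. t \<notin> Z"
  unfolding mem_Z_iff
  by (rule eventually_ne_zero_of_simple[OF A_deriv(1)]) (use simple_zero in auto)

text \<open>Near a zero \<open>s\<close> of \<open>A1\<close> the quotient \<open>A2 / A1\<close> has a simple pole, but its leading
  coefficient is purely imaginary. Hence \<open>R\<close> vanishes to second order, like \<open>\<rho> + D\<close>.\<close>

lemma removable_N: "removable_on Z N"
  unfolding removable_on_def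
proof
  fix s assume "s \<in> Z"
  then have s: "A1 s = 0" by (simp add: mem_Z_iff)
  let ?g = "\<lambda>t. 2 * p1 * R t - 2 * (p2 + p3) * D t - 2 * p4 * \<rho> t"
  have s0: "J s = 0" "R s = 0" using s by (simp_all add: calI_def calR_def)
  obtain j where j: "(J has_real_derivative j) (at s)"
    using DERIV_cmult[OF has_vector_derivative_complexD(2)[OF cnj_mult_deriv], of 2]
    unfolding calI_def by blast
  have Jlim: "((\<lambda>t. J t / (t - s)) \<longlongrightarrow> j) (at s)"
    using j s0 by (simp add: has_field_derivative_iff)
  \<comment> \<open>By L'Hopital, \<open>R' = J * ?g\<close> is compared with
    \<open>2 * (t - s)\<close>, and \<open>J\<close> has a first-order zero or better at
    \<open>s\<close>.\<close>
  have Rlim: "((\<lambda>t. R t / (t - s)\<^sup>2) \<longlongrightarrow> j * ?g s / 2) (at s)"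
  proof (rule lhopital[where f' = "\<lambda>t. J t * ?g t" and g' = "\<lambda>t. 2 * (t - s)"])
    show "(R \<longlongrightarrow> 0) (at s)"
      using isCont_quadratic(3)[of s] s0 by (simp add: isCont_def)
    show "((\<lambda>t. (t - s)\<^sup>2) \<longlongrightarrow> 0) (at s)"
      by (auto intro!: tendsto_eq_intros)
    show "\<forall>\<^sub>F t in at s. (t - s)\<^sup>2 \<noteq> 0" "\<forall>\<^sub>F t in at s. 2 * (t - s) \<noteq> 0"
      by (auto simp: eventually_at_filter)
    show "\<forall>\<^sub>F t in at s. (R has_real_derivative J t * ?g t) (at t)"
      using calR_deriv by simp
    show "\<forall>\<^sub>F t in at s. ((\<lambda>t. (t - s)\<^sup>2) has_real_derivative 2 * (t - s)) (at t)"
      by (intro always_eventually allI) (auto intro!: derivative_eq_intros)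
    have "(?g \<longlongrightarrow> ?g s) (at s)"
      using isCont_quadratic[of s] unfolding isCont_def by (intro tendsto_intros)
    then have "((\<lambda>t. J t / (t - s) * ?g t / 2) \<longlongrightarrow> j * ?g s / 2) (at s)"
      by (intro tendsto_mult tendsto_divide Jlim tendsto_const) auto
    then show "((\<lambda>t. J t * ?g t / (2 * (t - s))) \<longlongrightarrow> j * ?g s / 2) (at s)"
      by (simp add: mult.commute)
  qed
  \<comment> \<open>Since \<open>\<rho> + D\<close> is twice the squared modulus of
    \<open>A1\<close>, this is its leading coefficient at \<open>s\<close>, nonzero because the zero
    of \<open>A1\<close> is simple.\<close>
  define c where "c = 2 * (cmod (- \<i> * f1 s))\<^sup>2"
  have c: "c \<noteq> 0" using simple_zero[OF s] by (simp add: c_def)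
  have "((\<lambda>t. 2 * (cmod (A1 t / of_real (t - s)))\<^sup>2) \<longlongrightarrow> c) (at s)"
    unfolding c_def by (intro tendsto_intros tendsto_div_vector_derivative[OF A_deriv(1) s])
  then have Slim: "((\<lambda>t. (\<rho> t + D t) / (t - s)\<^sup>2) \<longlongrightarrow> c) (at s)"
    by (simp add: rho_def calD_def norm_divide power_divide flip: of_real_diff)
  have quot: "((\<lambda>t. X t / (\<rho> t + D t)) \<longlongrightarrow> x / c) (at s)"
    if "((\<lambda>t. X t / (t - s)\<^sup>2) \<longlongrightarrow> x) (at s)" for X x
    by (rule Lim_transform_eventually[OF tendsto_divide[OF that Slim c]])
      (auto simp: eventually_at_filter)
  note R1 = quot[OF Rlim]
  have R2: "((\<lambda>t. (R t)\<^sup>2 / (\<rho> t + D t)) \<longlongrightarrow> 0 * (j * ?g s / 2 / c)) (at s)"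
    using tendsto_mult[OF _ R1, of R 0] isCont_quadratic(3)[of s] s0
    by (simp add: isCont_def power2_eq_square)
  have J2: "((\<lambda>t. (J t)\<^sup>2 / (\<rho> t + D t)) \<longlongrightarrow> j\<^sup>2 / c) (at s)"
    by (rule quot) (use tendsto_power[OF Jlim, of 2] in \<open>simp add: power_divide\<close>)
  have R3: "((\<lambda>t. \<rho> t * R t / (\<rho> t + D t)) \<longlongrightarrow> \<rho> s * (j * ?g s / 2 / c)) (at s)"
    using tendsto_mult[OF _ R1, of \<rho> "\<rho> s"] isCont_quadratic(1)[of s]
    by (simp add: isCont_def)
  show "\<exists>l. (N \<longlongrightarrow> l) (at s)"
    unfolding N1_def Let_def
    by (rule exI) (rule R2 J2 R3 isCont_quadratic[unfolded isCont_def]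
        tendsto_add tendsto_diff tendsto_minus tendsto_mult tendsto_const)+
qed

lemma isCont_N_ext: "isCont (cont_ext Z N) t"
proof (rule isCont_cont_ext[OF removable_N _ eventually_not_in_Z])
  assume "t \<notin> Z"
  then have "\<rho> t + D t \<noteq> 0" by (simp add: Z1_def)
  then show "isCont N t"
    unfolding N1_def Let_def by (intro continuous_intros isCont_quadratic)
qed

section \<open>The phase and the direction of \<open>A1\<close>\<close>

lemma phase_deriv: "(\<phi> has_real_derivative cont_ext Z N t - V t) (at t)"
  unfolding phase1_def[abs_def]
  by (rule has_derivative_interval_integral) (intro continuous_intros isCont_N_ext isCont_quadratic)

text \<open>Identifies \<open>N - V\<close> as the angular velocity of \<open>A1\<close>, the
  imaginary part of \<open>A1' / A1 = - i f1 / A1\<close>.\<close>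

lemma N_eq:
  assumes "A1 t \<noteq> 0"
  shows "N t = V t - Re (cnj (A1 t) * f1 t) / (cmod (A1 t))\<^sup>2"
proof -
  define a b x y where "a = (cmod (A1 t))\<^sup>2" and "b = (cmod (A2 t))\<^sup>2"
    and "x = Re (cnj (A1 t) * A2 t)" and "y = Im (cnj (A1 t) * A2 t)"
  note defs = a_def[symmetric] b_def[symmetric] x_def[symmetric] y_def[symmetric]
  have "a \<noteq> 0" using assms by (simp add: a_def)
  have "a * b = (cmod (cnj (A1 t) * A2 t))\<^sup>2"
    by (simp add: a_def b_def norm_mult power_mult_distrib)
  then have "a * b = x\<^sup>2 + y\<^sup>2" by (simp add: x_def y_def cmod_power2)
  \<comment> \<open>The identity holds only modulo \<open>a * b = x^2 + y^2\<close>; eliminating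
    \<open>b\<close> turns it into an identity of rational functions.\<close>
  with \<open>a \<noteq> 0\<close> have b: "b = (x\<^sup>2 + y\<^sup>2) / a" by (simp add: field_simps)
  show ?thesis
    unfolding N1_def Let_def rho_def calD_def calR_def calI_def Re_cnj_mult_F1 defs
    unfolding b using \<open>a \<noteq> 0\<close> by (simp add: field_simps power2_eq_square)
qed

abbreviation "w t \<equiv> A1 t * exp (- \<i> * of_real (\<phi> t))"

text \<open>The rotation by the phase removes the angular velocity and leaves the rate of
  \<open>ln (cmod (A1 t))\<close>. At a zero of \<open>A1\<close> the derivative of the phase drops
  out of \<open>w'\<close>, so simplicity is inherited from \<open>A1\<close>.\<close>

lemma simple_zero_path_w:
  "simple_zero_path w
     (\<lambda>t. - \<i> * (f1 t + of_real (cont_ext Z N t - V t) * A1 t) * exp (- \<i> * of_real (\<phi> t)))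
     (\<lambda>t. Im (cnj (A1 t) * f1 t) / (cmod (A1 t))\<^sup>2)"
proof
  fix t
  have "((\<lambda>t. - \<i> * of_real (\<phi> t)) has_vector_derivative
      - \<i> * of_real (cont_ext Z N t - V t)) (at t)"
    by (intro has_vector_derivative_mult_right has_vector_derivative_of_real phase_deriv)
  from has_vector_derivative_mult[OF A_deriv(1) field_vector_diff_chain_at[OF this DERIV_exp]]
  show "(w has_vector_derivative
      - \<i> * (f1 t + of_real (cont_ext Z N t - V t) * A1 t) * exp (- \<i> * of_real (\<phi> t))) (at t)"
    unfolding o_def by (simp add: algebra_simps)
next
  fix s assume "w s = 0"
  then have "A1 s = 0" by simp
  with simple_zero[of s]
  show "- \<i> * (f1 s + of_real (cont_ext Z N s - V s) * A1 s) * exp (- \<i> * of_real (\<phi> s)) \<noteq> 0"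
    by auto
next
  fix t assume "w t \<noteq> 0"
  then have A: "A1 t \<noteq> 0" by simp
  let ?a = "(cmod (A1 t))\<^sup>2" and ?c = "cnj (A1 t) * f1 t"
  have "cont_ext Z N t = N t"
    using A by (simp add: cont_ext_def mem_Z_iff)
  then have W: "cont_ext Z N t - V t = - (Re ?c / ?a)"
    unfolding N_eq[OF A] by linarith
  \<comment> \<open>Writes \<open>f1 t\<close> as a complex multiple of \<open>A1 t\<close>; the
    real part of the multiplier cancels against \<open>N - V\<close>.\<close>
  have "f1 t = A1 t * ?c / of_real ?a"
    unfolding complex_norm_square using A by simp
  also have "?c = of_real (Re ?c) + \<i> * of_real (Im ?c)"
    by (rule complex_eq)
  finally have "- \<i> * (f1 t + of_real (cont_ext Z N t - V t) * A1 t) = of_real (Im ?c / ?a) * A1 t"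
    unfolding W using A by (simp add: field_simps del: complex_cnj_mult times_complex.sel)
  then show "- \<i> * (f1 t + of_real (cont_ext Z N t - V t) * A1 t) * exp (- \<i> * of_real (\<phi> t))
      = of_real (Im ?c / ?a) * w t"
    by (simp only: mult.assoc)
qed

section \<open>The reconstruction formulas\<close>

lemma Z_eq: "Z = {t. w t = 0}"
  by (auto simp: mem_Z_iff)

lemma finite_Z: "finite (Z \<inter> time_span t)"
  using simple_zero_path.finite_zeros[OF simple_zero_path_w] unfolding Z_eq time_span_def by simp

lemma rhs11_eq: "A1 t = rhs11 p1 p2 p3 p4 p5 q1 q2 q3 A1 A2 t"
proof (cases "A1 t = 0")
  \<comment> \<open>At a zero of \<open>A1\<close> the square root in \<open>rhs11\<close> vanishes,
    so the formula holds there without extension.\<close>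
  case True
  then show ?thesis by (simp add: rhs11_def rho_def calD_def)
next
  case False
  let ?E = "exp (\<i> * of_real (\<phi> t))"
  \<comment> \<open>Hence \<open>w\<close> and \<open>A1\<close> agree at time 0.\<close>
  have "\<phi> 0 = 0" by (simp add: phase1_def zero_ereal_def)
  have sgn_w: "sgn (w s) = sgn (A1 s) * exp (- \<i> * of_real (\<phi> s))" for s
    by (simp add: sgn_mult) (simp add: sgn_eq)
  have "sgn (w t) = (- 1) ^ k1 A1 A2 t * sgn (w 0)"
    using simple_zero_path.sgn_eq_parity[OF simple_zero_path_w, of t] False init
    unfolding k1_def Z_eq by simp
  then have "sgn (A1 t) * exp (- \<i> * of_real (\<phi> t)) * ?E = (- 1) ^ k1 A1 A2 t * sgn (A1 0) * ?E"
    unfolding sgn_w \<open>\<phi> 0 = 0\<close> by simp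
  then have "sgn (A1 t) = (- 1) ^ k1 A1 A2 t * sgn (A1 0) * ?E"
    by (simp add: mult.assoc flip: exp_add)
  moreover have "A1 t = of_real (cmod (A1 t)) * sgn (A1 t)"
    by (simp add: sgn_eq)
  moreover have "rhs11 p1 p2 p3 p4 p5 q1 q2 q3 A1 A2 t
      = of_real (cmod (A1 t)) * ((- 1) ^ k1 A1 A2 t * sgn (A1 0) * ?E)"
    by (simp add: rhs11_def rho_def calD_def sgn_eq mult_ac)
  ultimately show ?thesis by metis
qed

text \<open>By the formula for \<open>A1\<close>, the unit factor \<open>u\<close> equals
  \<open>A1 t / cmod (A1 t)\<close>; multiplied by \<open>cnj (A1 t) / cmod (A1 t)\<close> it gives
  1.\<close>

lemma rhs12_eq:
  assumes "t \<notin> Z"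
  shows "rhs12 p1 p2 p3 p4 p5 q1 q2 q3 A1 A2 t = A2 t"
proof -
  have A: "A1 t \<noteq> 0" using assms by (simp add: mem_Z_iff)
  define u where "u = (- 1) ^ k1 A1 A2 t * (A1 0 / of_real (cmod (A1 0)))
    * exp (\<i> * of_real (\<phi> t))"
  have u: "A1 t = of_real (cmod (A1 t)) * u"
    using rhs11_eq[of t] by (simp add: rhs11_def rho_def calD_def u_def mult_ac)
  have num: "of_real (R t) + \<i> * of_real (J t) = 2 * (cnj (A1 t) * A2 t)"
    by (simp add: complex_eq_iff calR_def calI_def)
  have den: "sqrt (2 * (\<rho> t + D t)) = 2 * cmod (A1 t)"
    by (rule real_sqrt_unique) (auto simp: rho_def calD_def power_mult_distrib)
  have "rhs12 p1 p2 p3 p4 p5 q1 q2 q3 A1 A2 t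
      = 2 * (cnj (A1 t) * A2 t) / of_real (2 * cmod (A1 t)) * u"
    unfolding rhs12_def num den u_def by (simp only: mult_ac)
  also have "\<dots> = cnj (A1 t) * (of_real (cmod (A1 t)) * u) * A2 t / of_real ((cmod (A1 t))\<^sup>2)"
    using A by (simp add: field_simps power2_eq_square)
  also have "\<dots> = A2 t"
    unfolding u[symmetric] complex_norm_square using A by simp
  finally show ?thesis .
qed

text \<open>Continuity of \<open>A2\<close> and isolation of the zeros give both the removability
  and the value of the extension.\<close>

lemma tendsto_rhs12: "(rhs12 p1 p2 p3 p4 p5 q1 q2 q3 A1 A2 \<longlongrightarrow> A2 t) (at t)"
proof (rule Lim_transform_eventually)
  show "(A2 \<longlongrightarrow> A2 t) (at t)" using isCont_A(2)[of t] by (simp add: isCont_def)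
  show "\<forall>\<^sub>F s in at t. A2 s = rhs12 p1 p2 p3 p4 p5 q1 q2 q3 A1 A2 s"
    using eventually_not_in_Z[of t] by eventually_elim (simp add: rhs12_eq)
qed

lemma reconstruction:
  "(\<forall>\<tau>. finite (Z \<inter> time_span \<tau>)) \<and>
   removable_on Z N \<and>
   removable_on Z (rhs12 p1 p2 p3 p4 p5 q1 q2 q3 A1 A2) \<and>
   (\<forall>\<tau>. A1 \<tau> = rhs11 p1 p2 p3 p4 p5 q1 q2 q3 A1 A2 \<tau> \<and>
        A2 \<tau> = cont_ext Z (rhs12 p1 p2 p3 p4 p5 q1 q2 q3 A1 A2) \<tau>)"
proof (intro conjI allI)
  show "removable_on Z (rhs12 p1 p2 p3 p4 p5 q1 q2 q3 A1 A2)"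
    using tendsto_rhs12 unfolding removable_on_def by blast
  show "A2 \<tau> = cont_ext Z (rhs12 p1 p2 p3 p4 p5 q1 q2 q3 A1 A2) \<tau>" for \<tau>
    using tendsto_Lim[OF _ tendsto_rhs12] by (simp add: cont_ext_def rhs12_eq)
qed (use finite_Z removable_N rhs11_eq in auto)

end

end

section \<open>The symmetry exchanging \<open>A1\<close> and \<open>A2\<close>\<close>

lemma swap_quantities:
  "rho A2 A1 = rho A1 A2" "calD A2 A1 t = - calD A1 A2 t"
  "calR A2 A1 = calR A1 A2" "calI A2 A1 t = - calI A1 A2 t"
  "calV q3 q2 q1 u2 u1 = calV q1 q2 q3 u1 u2"
  by (auto simp: rho_def calD_def calR_def calI_def calV_def)

text \<open>The exchange negates \<open>calD\<close> and \<open>calI\<close>, which turns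
  \<open>\<rho> + D\<close> into \<open>\<rho> - D\<close> and \<open>R + i J\<close> into its
  conjugate. Negating \<open>p1\<close> and \<open>p4\<close> accounts for the remaining sign
  differences between \<open>N1\<close> and \<open>N2\<close>.\<close>

lemma swap_reconstruction:
  "Z1 A2 A1 = Z2 A1 A2"
  "k1 A2 A1 = k2 A1 A2"
  "N1 (- p1) p2 p3 (- p4) p5 A2 A1 = N2 p1 p2 p3 p4 p5 A1 A2"
  "phase1 (- p1) p2 p3 (- p4) p5 q3 q2 q1 A2 A1 = phase2 p1 p2 p3 p4 p5 q1 q2 q3 A1 A2"
  "rhs11 (- p1) p2 p3 (- p4) p5 q3 q2 q1 A2 A1 = rhs22 p1 p2 p3 p4 p5 q1 q2 q3 A1 A2"
  "rhs12 (- p1) p2 p3 (- p4) p5 q3 q2 q1 A2 A1 = rhs21 p1 p2 p3 p4 p5 q1 q2 q3 A1 A2"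
proof -
  note swap = swap_quantities(1-4)[where ?A1.0 = A1 and ?A2.0 = A2]
  show Z: "Z1 A2 A1 = Z2 A1 A2"
    by (simp add: Z1_def Z2_def swap)
  show k: "k1 A2 A1 = k2 A1 A2"
    by (simp add: fun_eq_iff k1_def k2_def Z)
  show N: "N1 (- p1) p2 p3 (- p4) p5 A2 A1 = N2 p1 p2 p3 p4 p5 A1 A2"
    by (simp add: fun_eq_iff N1_def N2_def Let_def swap)
  show phase: "phase1 (- p1) p2 p3 (- p4) p5 q3 q2 q1 A2 A1 = phase2 p1 p2 p3 p4 p5 q1 q2 q3 A1 A2"
    by (simp add: fun_eq_iff phase1_def phase2_def Z N swap_quantities(5)[where ?q1.0 = q1 and ?q3.0 = q3])
  show "rhs11 (- p1) p2 p3 (- p4) p5 q3 q2 q1 A2 A1 = rhs22 p1 p2 p3 p4 p5 q1 q2 q3 A1 A2"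
    by (simp add: fun_eq_iff rhs11_def rhs22_def k phase swap mult_ac)
  show "rhs12 (- p1) p2 p3 (- p4) p5 q3 q2 q1 A2 A1 = rhs21 p1 p2 p3 p4 p5 q1 q2 q3 A1 A2"
    by (simp add: fun_eq_iff rhs12_def rhs21_def k phase swap mult_ac)
qed

lemma global_solution_swap:
  assumes "global_solution p1 p2 p3 p4 p5 q1 q2 q3 A1 A2"
  shows "global_solution (- p1) p2 p3 (- p4) p5 q3 q2 q1 A2 A1"
  using assms unfolding global_solution_def F_swap by auto

theorem theorem1p4:
  fixes p1 p2 p3 p4 p5 q1 q2 q3 :: real
    and A1 A2 :: "real \<Rightarrow> complex"
  assumes "p1 \<ge> 0" and "p3 \<ge> 0" and "p5 \<ge> 0"
    and "\<not> (p1 = 0 \<and> p2 = 0 \<and> p3 = 0 \<and> p4 = 0 \<and> p5 = 0)"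
    and "global_solution p1 p2 p3 p4 p5 q1 q2 q3 A1 A2"
    and "\<exists>t. (A1 t, A2 t) \<noteq> (0, 0)"
  shows "(\<forall>\<tau>. rho A1 A2 \<tau> = rho A1 A2 0) \<and>
    (A1 0 \<noteq> 0 \<longrightarrow>
       (\<forall>\<tau>. finite (Z1 A1 A2 \<inter> time_span \<tau>)) \<and>
       removable_on (Z1 A1 A2) (N1 p1 p2 p3 p4 p5 A1 A2) \<and>
       removable_on (Z1 A1 A2) (rhs12 p1 p2 p3 p4 p5 q1 q2 q3 A1 A2) \<and>
       (\<forall>\<tau>. A1 \<tau> = rhs11 p1 p2 p3 p4 p5 q1 q2 q3 A1 A2 \<tau> \<and>
            A2 \<tau> = cont_ext (Z1 A1 A2) (rhs12 p1 p2 p3 p4 p5 q1 q2 q3 A1 A2) \<tau>)) \<and>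
    (A2 0 \<noteq> 0 \<longrightarrow>
       (\<forall>\<tau>. finite (Z2 A1 A2 \<inter> time_span \<tau>)) \<and>
       removable_on (Z2 A1 A2) (N2 p1 p2 p3 p4 p5 A1 A2) \<and>
       removable_on (Z2 A1 A2) (rhs21 p1 p2 p3 p4 p5 q1 q2 q3 A1 A2) \<and>
       (\<forall>\<tau>. A1 \<tau> = cont_ext (Z2 A1 A2) (rhs21 p1 p2 p3 p4 p5 q1 q2 q3 A1 A2) \<tau> \<and>
            A2 \<tau> = rhs22 p1 p2 p3 p4 p5 q1 q2 q3 A1 A2 \<tau>))"
proof -
  interpret fst: cubic_solution p1 p2 p3 p4 p5 q1 q2 q3 A1 A2
    by unfold_locales (rule assms)
  interpret snd: cubic_solution "- p1" p2 p3 "- p4" p5 q3 q2 q1 A2 A1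
    by unfold_locales (rule global_solution_swap[OF assms(5)])
  note snd = snd.reconstruction[unfolded swap_reconstruction]
  show ?thesis
  proof (rule conjI, rule allI, rule fst.rho_const, rule conjI; rule impI)
    assume "A1 0 \<noteq> 0"
    then show "(\<forall>\<tau>. finite (Z1 A1 A2 \<inter> time_span \<tau>)) \<and>
       removable_on (Z1 A1 A2) (N1 p1 p2 p3 p4 p5 A1 A2) \<and>
       removable_on (Z1 A1 A2) (rhs12 p1 p2 p3 p4 p5 q1 q2 q3 A1 A2) \<and>
       (\<forall>\<tau>. A1 \<tau> = rhs11 p1 p2 p3 p4 p5 q1 q2 q3 A1 A2 \<tau> \<and>
            A2 \<tau> = cont_ext (Z1 A1 A2) (rhs12 p1 p2 p3 p4 p5 q1 q2 q3 A1 A2) \<tau>)"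
      by (rule fst.reconstruction)
  next
    assume "A2 0 \<noteq> 0"
    from snd[OF this]
    show "(\<forall>\<tau>. finite (Z2 A1 A2 \<inter> time_span \<tau>)) \<and>
       removable_on (Z2 A1 A2) (N2 p1 p2 p3 p4 p5 A1 A2) \<and>
       removable_on (Z2 A1 A2) (rhs21 p1 p2 p3 p4 p5 q1 q2 q3 A1 A2) \<and>
       (\<forall>\<tau>. A1 \<tau> = cont_ext (Z2 A1 A2) (rhs21 p1 p2 p3 p4 p5 q1 q2 q3 A1 A2) \<tau> \<and>
            A2 \<tau> = rhs22 p1 p2 p3 p4 p5 q1 q2 q3 A1 A2 \<tau>)"
      by blast
  qed
qed

end
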